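(* For every $s\in\mathbb{C}\setminus\{1\}$, Ser's series $$\frac{1}{s-1}\sum_{n=0}^\infty\frac{1}{n+2}\sum_{k=0}^{n}(-1)^k\binom{n}{k}(k+1)^{-s}$$ and Hasse's series $$\frac{1}{s-1}\sum_{n=0}^\infty\frac{1}{n+1}\sum_{k=0}^{n}(-1)^k\binom{n}{k}(k+1)^{1-s}$$ (each of which represents $\zeta(s)$) are equivalent: Hasse's series is obtained from Ser's series by a rearrangement of its terms, and vice versa.
   Context: $\zeta(s)$ denotes the Riemann zeta-function (analytically continued to $\mathbb{C}\setminus\{1\}$). *)

theory Defs
  imports "HOL-Complex_Analysis.Complex_Analysis"
begin

definition zeta_continuation :: "(complex \<Rightarrow> complex) \<Rightarrow> bool" where
  "zeta_continuation f \<longleftrightarrow>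
     f holomorphic_on - {1} \<and>
     (\<forall>s. Re s > 1 \<longrightarrow> (\<lambda>n. of_nat (Suc n) powr (- s)) sums f s)"

text \<open>
  The value at \<open>1\<close> is meaningless; for \<open>s \<noteq> 1\<close> uniqueness is lemma \<open>zeta_eqI\<close> below.
\<close>

definition zeta :: "complex \<Rightarrow> complex" where
  "zeta s = (THE w. \<exists>f. zeta_continuation f \<and> f s = w)"

lemma zeta_continuation_unique:
  assumes f: "zeta_continuation f" and g: "zeta_continuation g" and s: "s \<noteq> 1"
  shows "f s = g s"
proof -
  have half: "open {s. Re s > 1}" by (rule open_halfspace_Re_gt)
  have conn: "connected (- {1 :: complex})"
    by (rule connected_punctured_universe) simp
  have "f s - g s = 0"
  proof (rule analytic_continuation_open[where s = "{s. Re s > 1}" and s' = "- {1}"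
        and f = "\<lambda>z. f z - g z" and g = "\<lambda>_. 0"])
    show "{s :: complex. Re s > 1} \<noteq> {}"
      by (auto intro!: exI[of _ 2])
    show "(\<lambda>z. f z - g z) holomorphic_on - {1}"
      using f g by (auto simp: zeta_continuation_def intro!: holomorphic_intros)
    show "f z - g z = 0" if "z \<in> {s. Re s > 1}" for z
      using that f g sums_unique2 unfolding zeta_continuation_def by fastforce
  qed (use half conn s in \<open>auto intro: holomorphic_intros\<close>)
  then show ?thesis by simp
qed

lemma zeta_eqI:
  assumes "zeta_continuation f" and "s \<noteq> 1"
  shows "zeta s = f s"
  unfolding zeta_def using assms zeta_continuation_unique by blast

text \<open>
  Up to the common prefactor \<open>1 / (s - 1)\<close>, the individual terms of the two iterated series,
  indexed by the pairs \<open>(n, k)\<close> with \<open>k \<le> n\<close>.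
\<close>

definition term_index :: "(nat \<times> nat) set" where
  "term_index = {(n, k). k \<le> n}"

definition ser_term :: "complex \<Rightarrow> nat \<times> nat \<Rightarrow> complex" where
  "ser_term s = (\<lambda>(n, k).
     1 / of_nat (n + 2) * ((- 1) ^ k * of_nat (n choose k) * of_nat (k + 1) powr (- s)))"

definition hasse_term :: "complex \<Rightarrow> nat \<times> nat \<Rightarrow> complex" where
  "hasse_term s = (\<lambda>(n, k).
     1 / of_nat (n + 1) * ((- 1) ^ k * of_nat (n choose k) * of_nat (k + 1) powr (1 - s)))"

text \<open>
  \<open>collects J w g I x\<close>: the pieces \<open>w j\<close>, each used exactly once, are distributed by \<open>g\<close> into
  finite groups, and the group belonging to \<open>i\<close> adds up to the term \<open>x i\<close>.
\<close>

definition collects ::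
  "'j set \<Rightarrow> ('j \<Rightarrow> complex) \<Rightarrow> ('j \<Rightarrow> 'i) \<Rightarrow> 'i set \<Rightarrow> ('i \<Rightarrow> complex) \<Rightarrow> bool" where
  "collects J w g I x \<longleftrightarrow>
     g ` J \<subseteq> I \<and> (\<forall>i\<in>I. finite {j \<in> J. g j = i} \<and> x i = (\<Sum>j | j \<in> J \<and> g j = i. w j))"

text \<open>
  \<open>y\<close> arises from \<open>x\<close> by splitting every term of \<open>x\<close> into finitely many pieces \<open>w\<close> (along \<open>g\<close>)
  and regrouping the same pieces (along \<open>h\<close>). In general no permutation of the unsplit terms takes
  one of the two series to the other. The pieces and groupings are arguments rather than
  existentially quantified, because for arbitrary pieces such data exist between any two series:
  a rearrangement carries information only through its pieces.
\<close>

definition rearranges_to ::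
  "'j set \<Rightarrow> ('j \<Rightarrow> complex) \<Rightarrow> ('j \<Rightarrow> 'i) \<Rightarrow> ('j \<Rightarrow> 'i) \<Rightarrow> 'i set \<Rightarrow>
     ('i \<Rightarrow> complex) \<Rightarrow> ('i \<Rightarrow> complex) \<Rightarrow> bool" where
  "rearranges_to J w g h I x y \<longleftrightarrow> collects J w g I x \<and> collects J w h I y"

text \<open>
  The splitting comes from \<open>1 / (n + 2) = 1 - (n + 1) / (n + 2)\<close> on Ser's side and from
  \<open>(k + 1) * (n choose k) = (n + 1) * (n choose k) - n * ((n - 1) choose k)\<close> on Hasse's:
  the piece \<open>(n, k, True)\<close> is the first and \<open>(n, k, False)\<close> the second part of Ser's term \<open>(n, k)\<close>,
  and Hasse's term \<open>(n, k)\<close> consists of \<open>(n, k, True)\<close> and, if \<open>k < n\<close>, \<open>(n - 1, k, False)\<close>.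
\<close>

definition piece_index :: "(nat \<times> nat \<times> bool) set" where
  "piece_index = {(n, k, b). k \<le> n}"

definition piece :: "complex \<Rightarrow> nat \<times> nat \<times> bool \<Rightarrow> complex" where
  "piece s = (\<lambda>(n, k, b).
     (if b then 1 else - (of_nat (n + 1) / of_nat (n + 2))) *
     ((- 1) ^ k * of_nat (n choose k) * of_nat (k + 1) powr (- s)))"

definition ser_group :: "nat \<times> nat \<times> bool \<Rightarrow> nat \<times> nat" where
  "ser_group = (\<lambda>(n, k, b). (n, k))"

definition hasse_group :: "nat \<times> nat \<times> bool \<Rightarrow> nat \<times> nat" where
  "hasse_group = (\<lambda>(n, k, b). (if b then n else n + 1, k))"

end

theory Submission imports Defs begin

text \<open>
  Put \<open>D n j s = (\<Sum>k\<le>n. (- 1) ^ k * (n choose k) * (k + j + 1) powr (- s))\<close>.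
  For \<open>Re s > 0\<close>, \<open>Gamma s * D n j s\<close> is the integral of
  \<open>t powr (s - 1) * exp (- (j + 1) * t) * (1 - exp (- t)) ^ n\<close> over \<open>t > 0\<close>,
  and therefore \<open>D n j s\<close> is \<open>O(n powr (- (j + 1 / 2)))\<close> locally uniformly in \<open>s\<close>. The recurrence
  \<open>D n j (s - 1) = (j + 1) * D n j s - n * D (n - 1) (j + 1) s\<close>
  loses a factor \<open>n\<close> but raises \<open>j\<close>, so it carries the bound to the whole plane, and Hasse's
  series, with terms \<open>D n 0 (s - 1) / (n + 1)\<close>, is entire.

  For \<open>Re s > 1\<close>, the function \<open>t powr (s - 1) * exp (- t) / (1 - exp (- t))\<close> expands both as a
  geometric series in \<open>exp (- t)\<close> and, through \<open>t = - ln (1 - (1 - exp (- t)))\<close>, as a power series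
  in \<open>1 - exp (- t)\<close>; integrating the two expansions identifies the sum of Hasse's series with
  \<open>(s - 1) * zeta s\<close>. The regrouping of the pieces telescopes: the partial sums of the two series
  differ by \<open>D N 0 s\<close>, which tends to \<open>0\<close>.
\<close>

section \<open>Laplace transforms of powers\<close>

text \<open>The substitution of \<open>c * t\<close> for \<open>t\<close> in Euler's integral for
  \<open>Gamma s\<close>.\<close>

lemma laplace_transform_powr:
  fixes s :: complex and c :: real
  assumes "Re s > 0" "c > 0"
  shows "has_bochner_integral lborel
    (\<lambda>t. indicator {0<..} t *\<^sub>R (of_real t powr (s - 1) * of_real (exp (- c * t))))
    (Gamma s * of_real c powr (- s))"
proof -
  define f where "f = (\<lambda>c t. indicator {0<..} t *\<^sub>R
    (of_real t powr (s - 1) * of_real (exp (- c * t)) :: complex))"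
  \<comment> \<open>For \<open>t > 0\<close> the power is an exponential of the real logarithm; in
    this form Borel measurability can be read off factor by factor. It is needed below to pass from
    \<open>lebesgue\<close> to \<open>lborel\<close>.\<close>
  have f_exp: "f c = (\<lambda>t. indicator {0<..} t *\<^sub>R
    (exp ((s - 1) * of_real (ln t)) * of_real (exp (- c * t))))" for c
    by (auto simp: f_def fun_eq_iff indicator_def powr_def Ln_of_real)
  have meas: "f c \<in> borel_measurable lborel" for c
    unfolding f_exp by measurable
  have 1: "(\<lambda>t. of_real t powr (s - 1) / of_real (exp t) :: complex) absolutely_integrable_on {0<..}"
    by (rule absolutely_integrable_Gamma_integral'[OF assms(1)])
  have f1: "f 1 = (\<lambda>t. indicator {0<..} t *\<^sub>R (of_real t powr (s - 1) / of_real (exp t)))"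
    by (auto simp: f_def fun_eq_iff exp_minus field_simps)
  have "integrable lebesgue (f 1)"
    using 1 by (simp add: f1 set_integrable_def)
  moreover have "integral\<^sup>L lebesgue (f 1) = Gamma s"
    using has_integral_unique[OF has_integral_set_lebesgue[OF 1] Gamma_integral_complex'[OF assms(1)]]
    by (simp add: f1 set_lebesgue_integral_def)
  ultimately have "has_bochner_integral lborel (f 1) (Gamma s)"
    using meas[of 1]
    by (simp add: has_bochner_integral_iff integrable_completion integral_completion)
  hence "has_bochner_integral lborel (\<lambda>t. f 1 (0 + c * t)) (Gamma s /\<^sub>R \<bar>c\<bar>)"
    using assms(2) by (subst (asm) lborel_has_bochner_integral_real_affine_iff[of c _ _ 0]) auto
  \<comment> \<open>The factor \<open>c powr (1 - s)\<close> cancels the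
    \<open>c powr (s - 1)\<close> that the substitution pulls out of the power of
    \<open>t\<close>.\<close>
  hence "has_bochner_integral lborel (\<lambda>t. of_real c powr (1 - s) * f 1 (0 + c * t))
      (of_real c powr (1 - s) * (Gamma s /\<^sub>R \<bar>c\<bar>))"
    by (rule has_bochner_integral_mult_right)
  moreover have "(\<lambda>t. of_real c powr (1 - s) * f 1 (0 + c * t)) = f c"
  proof
    fix t :: real
    have "of_real c powr (1 - s) * f 1 (c * t) = f c t" if "t > 0"
    proof -
      have "of_real (c * t) powr (s - 1) = of_real c powr (s - 1) * (of_real t powr (s - 1) :: complex)"
        using that assms by (simp add: powr_times_real)
      moreover have "of_real c powr (1 - s) * of_real c powr (s - 1) = (1::complex)"
        using assms by (simp flip: powr_add)
      ultimately show ?thesis using that assms by (simp add: f_def zero_less_mult_iff)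
    qed
    thus "of_real c powr (1 - s) * f 1 (0 + c * t) = f c t"
      using assms by (cases "t > 0") (auto simp: f_def zero_less_mult_iff)
  qed
  moreover have "of_real c powr (1 - s) * (Gamma s /\<^sub>R \<bar>c\<bar>) = Gamma s * of_real c powr (- s)"
    using assms by (simp add: powr_diff powr_minus scaleR_conv_of_real field_simps)
  ultimately show ?thesis by (simp add: f_def)
qed

lemma laplace_transform_powr_real:
  fixes \<sigma> c :: real
  assumes "\<sigma> > 0" "c > 0"
  shows "has_bochner_integral lborel
    (\<lambda>t. indicator {0<..} t * (t powr (\<sigma> - 1) * exp (- c * t)))
    (Gamma \<sigma> * c powr (- \<sigma>))"
proof -
  have "has_bochner_integral lborel
    (\<lambda>t. Re (indicator {0<..} t *\<^sub>R (of_real t powr (of_real \<sigma> - 1) * of_real (exp (- c * t)))))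
    (Re (Gamma (of_real \<sigma>) * of_real c powr (- of_real \<sigma>)))"
    by (rule has_bochner_integral_bounded_linear[OF bounded_linear_Re])
       (rule laplace_transform_powr, use assms in auto)
  moreover have "(Gamma (of_real \<sigma>) * of_real c powr (- of_real \<sigma>)) =
      complex_of_real (Gamma \<sigma> * c powr (- \<sigma>))"
    using assms by (simp add: Gamma_complex_of_real flip: powr_of_real)
  moreover have "Re (indicator {0<..} t *\<^sub>R (of_real t powr (of_real \<sigma> - 1) * of_real (exp (- c * t))))
     = indicator {0<..} t * (t powr (\<sigma> - 1) * exp (- c * t))" for t
  proof (cases "t > 0")
    case True
    have "of_real t powr (of_real \<sigma> - 1) = complex_of_real (t powr (\<sigma> - 1))"
      using True by (simp flip: powr_of_real)
    thus ?thesis using True by simp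
  qed auto
  ultimately show ?thesis by (metis (no_types, lifting) Re_complex_of_real has_bochner_integral_cong)
qed

section \<open>Elementary inequalities for the kernel\<close>

text \<open>The inequality \<open>ln x \<le> x - 1\<close> at \<open>x = y / a\<close>, weakened to
  \<open>ln x \<le> x\<close>, multiplied by \<open>a\<close> and exponentiated.\<close>

lemma powr_le_exp:
  fixes y a :: real
  assumes "y > 0" "a > 0"
  shows "y powr a \<le> a powr a * exp y"
proof -
  have "ln (y / a) \<le> y / a" using assms ln_le_minus_one[of "y/a"] by simp
  hence "a * ln y \<le> a * ln a + y" using assms by (simp add: ln_div field_simps)
  hence "exp (a * ln y) \<le> exp (a * ln a + y)" by simp
  thus ?thesis using assms by (simp add: powr_def exp_add)
qed

text \<open>With \<open>y = (n + 1) * x\<close>, the power \<open>(1 - x) ^ n\<close> decays like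
  \<open>exp (- y)\<close>, which pays for the growth of \<open>y powr a\<close>; the remaining
  factor is \<open>(n + 1) powr (- a)\<close>.\<close>

lemma powr_mult_one_minus_power_le:
  fixes x a :: real
  assumes x: "0 < x" "x < 1" and a: "a > 0"
  shows "x powr a * (1 - x) ^ n \<le> exp 1 * a powr a * real (n + 1) powr (- a)"
proof -
  define y where "y = real (n + 1) * x"
  have "1 - x \<le> exp (- x)" using exp_ge_add_one_self[of "- x"] by simp
  hence "(1 - x) ^ n \<le> exp (- x) ^ n" using x by (intro power_mono) auto
  also have "\<dots> = exp (- (real n * x))" by (simp flip: exp_of_nat_mult)
  \<comment> \<open>Passing from \<open>n * x\<close> to \<open>y = n * x + x\<close> costs at most
    a factor \<open>exp 1\<close>, because \<open>x < 1\<close>; in return the bound also makes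
    sense at \<open>n = 0\<close>.\<close>
  also have "\<dots> \<le> exp (1 - y)" using x by (simp add: y_def algebra_simps)
  finally have "(1 - x) ^ n \<le> exp (1 - y)" .
  hence "x powr a * (1 - x) ^ n \<le> x powr a * exp (1 - y)" by (intro mult_left_mono) auto
  also have "\<dots> = y powr a * real (n + 1) powr (- a) * exp (1 - y)"
    using x by (simp add: y_def powr_mult powr_minus)
  also have "\<dots> \<le> (a powr a * exp y * real (n + 1) powr (- a)) * exp (1 - y)"
    using x a by (intro mult_right_mono powr_le_exp) (auto simp: y_def)
  also have "\<dots> = exp 1 * a powr a * real (n + 1) powr (- a)"
    by (simp add: exp_diff)
  finally show ?thesis .
qed

section \<open>Finite differences of powers and their integral representation\<close>

text \<open>Up to sign, the \<open>n\<close>-th forward difference of \<open>x powr (- s)\<close> at \<open>x = j + 1\<close>.\<close>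

definition shifted_diff :: "nat \<Rightarrow> nat \<Rightarrow> complex \<Rightarrow> complex" where
  "shifted_diff n j s =
     (\<Sum>k\<le>n. (- 1) ^ k * of_nat (n choose k) * of_nat (k + j + 1) powr (- s))"

definition laplace_kernel :: "complex \<Rightarrow> nat \<Rightarrow> nat \<Rightarrow> real \<Rightarrow> complex" where
  "laplace_kernel s n j t = indicator {0<..} t *\<^sub>R
     (of_real t powr (s - 1) * of_real (exp (- real (j + 1) * t) * (1 - exp (- t)) ^ n))"

text \<open>The binomial expansion of \<open>(1 - exp (- t)) ^ n\<close> writes the kernel as a
  linear combination of the integrands of \<open>laplace_transform_powr\<close> with
  \<open>c = k + j + 1\<close>.\<close>

lemma has_bochner_integral_laplace_kernel:
  assumes "Re s > 0"
  shows "has_bochner_integral lborel (laplace_kernel s n j) (Gamma s * shifted_diff n j s)"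
proof -
  have "has_bochner_integral lborel
    (\<lambda>t. \<Sum>k\<le>n. ((- 1) ^ k * of_nat (n choose k)) * (indicator {0<..} t *\<^sub>R
        (of_real t powr (s - 1) * of_real (exp (- real (k + j + 1) * t)))))
    (\<Sum>k\<le>n. ((- 1) ^ k * of_nat (n choose k)) * (Gamma s * of_real (real (k + j + 1)) powr (- s)))"
    by (intro has_bochner_integral_sum has_bochner_integral_mult_right laplace_transform_powr assms)
       auto
  moreover have "(\<Sum>k\<le>n. ((- 1) ^ k * of_nat (n choose k)) *
      (Gamma s * of_real (real (k + j + 1)) powr (- s))) = Gamma s * shifted_diff n j s"
    by (simp add: shifted_diff_def sum_distrib_left mult_ac)
  moreover have "(\<Sum>k\<le>n. ((- 1) ^ k * of_nat (n choose k)) * (indicator {0<..} t *\<^sub>R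
        (of_real t powr (s - 1) * of_real (exp (- real (k + j + 1) * t))))) = laplace_kernel s n j t" for t
  proof -
    have "(1 - exp (- t)) ^ n = (\<Sum>k\<le>n. of_nat (n choose k) * (- exp (- t)) ^ k)"
      using binomial_ring[of "- exp (- t)" 1 n] by simp
    hence "exp (- real (j + 1) * t) * (1 - exp (- t)) ^ n =
        (\<Sum>k\<le>n. (- 1) ^ k * of_nat (n choose k) * (exp (- real (j + 1) * t) * exp (- t) ^ k))"
      by (simp add: sum_distrib_left power_minus[of "exp (- t)"] mult_ac)
    also have "\<dots> = (\<Sum>k\<le>n. (- 1) ^ k * of_nat (n choose k) * exp (- real (k + j + 1) * t))"
      by (intro sum.cong refl arg_cong2[of _ _ _ _ "(*)"])
         (simp add: algebra_simps flip: exp_of_nat_mult exp_add)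
    finally show ?thesis
      by (simp add: laplace_kernel_def scaleR_sum_right sum_distrib_left mult_ac)
  qed
  ultimately show ?thesis by simp
qed

lemma integral_norm_laplace_kernel_le:
  fixes s j
  assumes "Re s > 0"
  defines "a \<equiv> real j + 1 / 2"
  shows "(\<integral>t. norm (laplace_kernel s n j t) \<partial>lborel) \<le>
     exp 1 * a powr a * real (n + 1) powr (- a) * (Gamma (Re s) * 2 powr (Re s))"
proof -
  have a: "a > 0" by (simp add: a_def)
  define K where "K = exp 1 * a powr a * real (n + 1) powr (- a)"
  have r: "has_bochner_integral lborel
    (\<lambda>t. indicator {0<..} t * (t powr (Re s - 1) * exp (- (1/2) * t)))
    (Gamma (Re s) * (1/2) powr (- Re s))"
    by (rule laplace_transform_powr_real) (use assms in auto)
  have "(\<integral>t. norm (laplace_kernel s n j t) \<partial>lborel) \<le>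
     (\<integral>t. K * (indicator {0<..} t * (t powr (Re s - 1) * exp (- (1/2) * t))) \<partial>lborel)"
  proof (rule integral_mono)
    show "integrable lborel (\<lambda>t. norm (laplace_kernel s n j t))"
      using has_bochner_integral_laplace_kernel[OF assms(1)]
      by (intro integrable_norm) (auto simp: has_bochner_integral_iff)
    show "integrable lborel (\<lambda>t. K * (indicator {0<..} t * (t powr (Re s - 1) * exp (- (1/2) * t))))"
      using r by (intro integrable_mult_right) (auto simp: has_bochner_integral_iff)
    fix t :: real
    show "norm (laplace_kernel s n j t) \<le>
        K * (indicator {0<..} t * (t powr (Re s - 1) * exp (- (1/2) * t)))"
    proof (cases "t > 0")
      case True
      \<comment> \<open>The exponent \<open>j + 1\<close> is split as \<open>a + 1 / 2\<close>: the
        part \<open>exp (- t) powr a\<close> produces the decay in \<open>n\<close>, with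
        \<open>x = exp (- t)\<close>, and the part \<open>exp (- t / 2)\<close> keeps the integral
        finite and yields the factor \<open>2 powr Re s\<close>.\<close>
      have "exp (- real (j + 1) * t) * (1 - exp (- t)) ^ n =
          (exp (- t) powr a * (1 - exp (- t)) ^ n) * exp (- (1/2) * t)"
        by (simp add: powr_def a_def algebra_simps flip: exp_add)
      also have "\<dots> \<le> K * exp (- (1/2) * t)"
        unfolding K_def using True a by (intro mult_right_mono powr_mult_one_minus_power_le) auto
      finally have "exp (- real (j + 1) * t) * (1 - exp (- t)) ^ n \<le> K * exp (- (1/2) * t)" .
      hence "t powr (Re s - 1) * (exp (- real (j + 1) * t) * (1 - exp (- t)) ^ n) \<le>
          t powr (Re s - 1) * (K * exp (- (1/2) * t))" by (intro mult_left_mono) auto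
      thus ?thesis using True
        by (simp add: laplace_kernel_def norm_mult norm_power norm_powr_real_powr mult_ac flip: of_real_diff)
    qed (auto simp: laplace_kernel_def)
  qed
  also have "\<dots> = K * (Gamma (Re s) * (1/2) powr (- Re s))"
    using has_bochner_integral_mult_right[OF r, of K] by (simp add: has_bochner_integral_iff)
  also have "(1/2) powr (- Re s) = (2::real) powr (Re s)"
    by (simp add: powr_divide powr_minus)
  finally show ?thesis by (simp add: K_def)
qed

text \<open>Lowering \<open>s\<close> by one brings in a factor \<open>k + j + 1\<close>, split as
  \<open>(j + 1) + k\<close>. The part \<open>k\<close> is absorbed through
  \<open>k * (n choose k) = n * ((n - 1) choose (k - 1))\<close>, and the index shift turns
  \<open>j\<close> into \<open>j + 1\<close>. At \<open>n = 0\<close> the truncated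
  \<open>n - 1\<close> is harmless because of the factor \<open>n\<close>.\<close>

lemma shifted_diff_minus_one:
  "shifted_diff n j (s - 1) =
     of_nat (j + 1) * shifted_diff n j s - of_nat n * shifted_diff (n - 1) (j + 1) s"
proof -
  have "shifted_diff n j (s - 1) = (\<Sum>k\<le>n. of_nat (k + j + 1) *
      ((- 1) ^ k * of_nat (n choose k) * of_nat (k + j + 1) powr (- s)))"
    unfolding shifted_diff_def
  proof (intro sum.cong refl)
    fix k
    have "of_nat (k + j + 1) powr (- (s - 1)) =
        of_nat (k + j + 1) powr 1 * (of_nat (k + j + 1) powr (- s) :: complex)"
      unfolding powr_add[symmetric] by simp
    also have "of_nat (k + j + 1) powr 1 = (of_nat (k + j + 1) :: complex)"
      by (rule powr_to_1)
    finally show "(- 1) ^ k * of_nat (n choose k) * of_nat (k + j + 1) powr (- (s - 1)) =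
        of_nat (k + j + 1) * ((- 1) ^ k * of_nat (n choose k) * of_nat (k + j + 1) powr (- s) :: complex)"
      by (simp only: mult_ac)
  qed
  also have "\<dots> = of_nat (j + 1) * shifted_diff n j s +
      (\<Sum>k\<le>n. of_nat k * ((- 1) ^ k * of_nat (n choose k) * of_nat (k + j + 1) powr (- s)))"
    unfolding shifted_diff_def sum_distrib_left sum.distrib[symmetric]
    by (intro sum.cong refl) (simp add: algebra_simps)
  also have "(\<Sum>k\<le>n. of_nat k * ((- 1) ^ k * of_nat (n choose k) * of_nat (k + j + 1) powr (- s)))
      = - (of_nat n * shifted_diff (n - 1) (j + 1) s)"
  proof (cases n)
    case (Suc m)
    have absorb: "of_nat (Suc i) * of_nat (Suc m choose Suc i) =
        (of_nat (Suc m) * of_nat (m choose i) :: complex)" for i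
      unfolding of_nat_mult[symmetric] Suc_times_binomial ..
    have "(\<Sum>k\<le>Suc m. of_nat k *
        ((- 1) ^ k * of_nat (Suc m choose k) * of_nat (k + j + 1) powr (- s))) =
      (\<Sum>i\<le>m. (- 1) ^ Suc i * (of_nat (Suc i) * of_nat (Suc m choose Suc i)) *
        (of_nat (Suc i + j + 1) powr (- s) :: complex))"
      by (subst sum.atMost_Suc_shift) (simp add: mult_ac del: binomial_Suc_Suc of_nat_Suc)
    thus ?thesis unfolding absorb using Suc
      by (simp add: shifted_diff_def sum_distrib_left sum_negf mult_ac del: of_nat_Suc)
  qed auto
  finally show ?thesis by simp
qed

section \<open>Locally uniform decay of the differences on the whole plane\<close>

lemma norm_shifted_diff_le:
  fixes s j
  assumes "Re s > 0"
  defines "a \<equiv> real j + 1 / 2"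
  shows "norm (shifted_diff n j s) \<le> exp 1 * a powr a *
     (norm (rGamma s) * (Gamma (Re s) * 2 powr (Re s))) * real (n + 1) powr (- a)"
proof -
  have s: "s \<notin> \<int>\<^sub>\<le>\<^sub>0" using assms(1) by (auto elim!: nonpos_Ints_cases)
  have "shifted_diff n j s = rGamma s * (Gamma s * shifted_diff n j s)"
    using s by (simp add: rGamma_inverse_Gamma Gamma_eq_zero_iff)
  also have "Gamma s * shifted_diff n j s = (\<integral>t. laplace_kernel s n j t \<partial>lborel)"
    using has_bochner_integral_laplace_kernel[OF assms(1)] by (simp add: has_bochner_integral_iff)
  finally have "norm (shifted_diff n j s) =
      norm (rGamma s) * norm (\<integral>t. laplace_kernel s n j t \<partial>lborel)"
    by (simp add: norm_mult)
  also have "\<dots> \<le> norm (rGamma s) *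
      (exp 1 * a powr a * real (n + 1) powr (- a) * (Gamma (Re s) * 2 powr (Re s)))"
    unfolding a_def
    by (intro mult_left_mono order.trans[OF integral_norm_bound integral_norm_laplace_kernel_le] assms) auto
  finally show ?thesis by (simp add: mult_ac)
qed

text \<open>Induction on \<open>p\<close>, widening the half-plane by one with the recurrence at
  \<open>s + 1\<close>. The second term there gains a factor \<open>n\<close>, but its order
  \<open>j + 1\<close> decays faster by exactly one power; hence \<open>j\<close> must be arbitrary
  in the induction. For \<open>p = 0\<close> the constant of \<open>norm_shifted_diff_le\<close> is
  continuous in \<open>s\<close>, so it is bounded on \<open>K\<close>.\<close>

lemma shifted_diff_bound_halfplane:
  assumes "compact K" "\<And>s. s \<in> K \<Longrightarrow> Re s > - real p"
  shows "\<exists>C\<ge>0. \<forall>s\<in>K. \<forall>n. norm (shifted_diff n j s) \<le> C * real (n + 1) powr (- (real j + 1 / 2))"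
  using assms
proof (induction p arbitrary: K j)
  case 0
  have "continuous_on K (\<lambda>s. norm (rGamma s) * (Gamma (Re s) * 2 powr (Re s)))"
    using 0 by (intro continuous_intros continuous_on_compose2[OF continuous_on_Gamma[of "{0<..}"]])
      (auto elim!: nonpos_Ints_cases)
  from compact_continuous_image[OF this 0(1)] obtain M where M: "M > 0"
    "\<And>s. s \<in> K \<Longrightarrow> norm (norm (rGamma s) * (Gamma (Re s) * 2 powr (Re s))) \<le> M"
    using bounded_pos compact_imp_bounded by (metis (no_types, lifting) imageI)
  define a where "a = real j + 1 / 2"
  have "norm (shifted_diff n j s) \<le> exp 1 * a powr a * M * real (n + 1) powr (- a)" if "s \<in> K" for s n
  proof -
    have "norm (shifted_diff n j s) \<le> exp 1 * a powr a *
       (norm (rGamma s) * (Gamma (Re s) * 2 powr (Re s))) * real (n + 1) powr (- a)"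
      unfolding a_def using 0(2)[OF that] by (intro norm_shifted_diff_le) auto
    also have "\<dots> \<le> exp 1 * a powr a * M * real (n + 1) powr (- a)"
      using M(2)[OF that] by (intro mult_right_mono mult_left_mono) auto
    finally show ?thesis .
  qed
  thus ?case using M(1) unfolding a_def
    by (intro exI[of _ "exp 1 * a powr a * M"]) (auto simp: a_def)
next
  case (Suc p)
  define a where "a = real j + 1 / 2"
  have a: "a > 0" by (simp add: a_def)
  have K': "compact ((\<lambda>s. s + 1) ` K)"
    by (intro compact_continuous_image continuous_intros Suc.prems)
  have K'': "Re s > - real p" if "s \<in> (\<lambda>s. s + 1) ` K" for s
    using that Suc.prems(2) by force
  obtain C where C: "C \<ge> 0"
    "\<And>s n. s \<in> K \<Longrightarrow> norm (shifted_diff n j (s + 1)) \<le> C * real (n + 1) powr (- a)"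
    using Suc.IH[OF K' K'', of j] unfolding a_def by blast
  obtain C' where C': "C' \<ge> 0"
    "\<And>s n. s \<in> K \<Longrightarrow> norm (shifted_diff n (j + 1) (s + 1)) \<le> C' * real (n + 1) powr (- (a + 1))"
    using Suc.IH[OF K' K'', of "j + 1"] unfolding a_def by (auto simp: add_ac)
  have "norm (shifted_diff n j s) \<le> (real (j + 1) * C + 2 powr a * C') * real (n + 1) powr (- a)"
    if s: "s \<in> K" for s n
  proof -
    have 2: "real n * norm (shifted_diff (n - 1) (j + 1) (s + 1)) \<le>
        2 powr a * C' * real (n + 1) powr (- a)"
    proof (cases "n = 0")
      case False
      have "real n * norm (shifted_diff (n - 1) (j + 1) (s + 1)) \<le> real n * (C' * real n powr (- (a + 1)))"
        using C'(2)[OF s, of "n - 1"] False by (intro mult_left_mono) auto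
      also have "\<dots> = C' * real n powr (- a)"
        using False by (simp add: powr_diff)
      \<comment> \<open>For \<open>n \<ge> 1\<close> one has \<open>n + 1 \<le> 2 * n\<close>,
        whence the constant \<open>2 powr a\<close>.\<close>
      also have "real n powr (- a) \<le> 2 powr a * real (n + 1) powr (- a)"
      proof -
        have "real (n + 1) powr a \<le> (2 * real n) powr a"
          using False a by (intro powr_mono2) auto
        thus ?thesis using False by (simp add: powr_minus powr_mult field_simps)
      qed
      finally show ?thesis using C'(1) by (simp add: mult_ac mult_right_mono)
    qed (use C' in auto)
    have "norm (shifted_diff n j s) \<le> real (j + 1) * norm (shifted_diff n j (s + 1)) +
        real n * norm (shifted_diff (n - 1) (j + 1) (s + 1))"
    proof -
      have "shifted_diff n j s = of_nat (j + 1) * shifted_diff n j (s + 1) -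
          of_nat n * shifted_diff (n - 1) (j + 1) (s + 1)"
        using shifted_diff_minus_one[of n j "s + 1"] by simp
      thus ?thesis using norm_triangle_ineq4[of "of_nat (j + 1) * shifted_diff n j (s + 1)"
          "of_nat n * shifted_diff (n - 1) (j + 1) (s + 1)"] by (simp only: norm_mult norm_of_nat)
    qed
    also have "\<dots> \<le> real (j + 1) * (C * real (n + 1) powr (- a)) + 2 powr a * C' * real (n + 1) powr (- a)"
      using C(2)[OF s, of n] 2 by (intro add_mono mult_left_mono) auto
    finally show ?thesis by (simp add: algebra_simps)
  qed
  thus ?case using C(1) C'(1) unfolding a_def
    by (intro exI[of _ "real (j + 1) * C + 2 powr a * C'"]) (auto simp: a_def)
qed

text \<open>A compact set is bounded, so it lies in one of the half-planes already treated.\<close>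

lemma shifted_diff_bound:
  assumes "compact K"
  shows "\<exists>C. \<forall>s\<in>K. \<forall>n. norm (shifted_diff n j s) \<le> C * real (n + 1) powr (- (real j + 1 / 2))"
proof -
  obtain M where M: "\<And>s. s \<in> K \<Longrightarrow> norm s \<le> M"
    using compact_imp_bounded[OF assms] by (auto simp: bounded_iff)
  obtain p :: nat where p: "M < real p" using reals_Archimedean2 by blast
  have "Re s > - real p" if "s \<in> K" for s
    using M[OF that] p abs_Re_le_cmod[of s] by linarith
  from shifted_diff_bound_halfplane[OF assms this] show ?thesis by blast
qed

lemma shifted_diff_tendsto_0: "(\<lambda>n. shifted_diff n j s) \<longlonglongrightarrow> 0"
proof -
  obtain C where C: "norm (shifted_diff n j s) \<le> C * real (n + 1) powr (- (real j + 1 / 2))" for n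
    using shifted_diff_bound[OF compact_sing[of s], of j] by blast
  have "filterlim (\<lambda>n. real (n + 1)) at_top sequentially"
    by (rule filterlim_compose[OF filterlim_real_sequentially filterlim_add_const_nat_at_top])
  hence "(\<lambda>n. real (n + 1) powr (- (real j + 1 / 2))) \<longlonglongrightarrow> 0"
    by (intro tendsto_neg_powr) auto
  hence "(\<lambda>n. C * real (n + 1) powr (- (real j + 1 / 2))) \<longlonglongrightarrow> 0"
    by (rule tendsto_mult_right_zero)
  thus ?thesis
    by (rule Lim_null_comparison[rotated]) (intro always_eventually allI C)
qed

section \<open>Hasse's series as an entire function\<close>

lemma summable_powr_three_halves: "summable (\<lambda>n. C * real (n + 1) powr (- (1 / 2)) / real (n + 1))"
proof -
  have "summable (\<lambda>n. real n powr (- (3 / 2)))" by (simp add: summable_real_powr_iff)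
  hence "summable (\<lambda>n. C * real (n + 1) powr (- (3 / 2)))"
    using summable_ignore_initial_segment[of _ 1] by (intro summable_mult) blast
  moreover have "C * real (n + 1) powr (- (3 / 2)) = C * real (n + 1) powr (- (1 / 2)) / real (n + 1)" for n
    using powr_add[of "real (n + 1)" "- (1/2)" "- 1"] by (simp add: powr_minus field_simps)
  ultimately show ?thesis by (simp only:)
qed

text \<open>The Weierstrass test on unit discs: for \<open>j = 0\<close> the terms are there
  dominated by a multiple of \<open>(n + 1) powr (- 3 / 2)\<close>. Hasse's series is this one at
  \<open>s - 1\<close>.\<close>

lemma shifted_diff_series_holomorphic:
  obtains g where "g holomorphic_on UNIV" "\<And>s. (\<lambda>n. shifted_diff n 0 s / of_nat (n + 1)) sums g s"
proof -
  have "\<exists>g g'. \<forall>s\<in>UNIV. ((\<lambda>n. shifted_diff n 0 s / of_nat (n + 1)) sums g s) \<and>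
      ((\<lambda>n. deriv (\<lambda>s. shifted_diff n 0 s / of_nat (n + 1)) s) sums g' s) \<and>
      (g has_field_derivative g' s) (at s)"
  proof (rule series_and_derivative_comparison_local)
    fix n :: nat and s :: complex
    have "(\<lambda>s. shifted_diff n 0 s / of_nat (n + 1)) holomorphic_on UNIV"
      unfolding shifted_diff_def by (intro holomorphic_intros) (auto simp flip: of_nat_Suc)
    thus "((\<lambda>s. shifted_diff n 0 s / of_nat (n + 1)) has_field_derivative
        deriv (\<lambda>s. shifted_diff n 0 s / of_nat (n + 1)) s) (at s)"
      by (rule holomorphic_derivI) auto
  next
    fix s :: complex
    obtain C where C: "norm (shifted_diff n 0 w) \<le> C * real (n + 1) powr (- (1 / 2))"
      if "w \<in> cball s 1" for w n
      using shifted_diff_bound[OF compact_cball[of s 1], of 0] unfolding of_nat_0 add_0 by blast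
    have "norm (shifted_diff n 0 w / of_nat (n + 1)) \<le> C * real (n + 1) powr (- (1 / 2)) / real (n + 1)"
      if "w \<in> ball s 1" for w n
      unfolding norm_divide norm_of_nat using that by (intro divide_right_mono C) auto
    thus "\<exists>d h. 0 < d \<and> summable h \<and> (\<forall>\<^sub>F n in sequentially. \<forall>w\<in>ball s d \<inter> UNIV.
        norm (shifted_diff n 0 w / of_nat (n + 1)) \<le> h n)"
      using summable_powr_three_halves[of C]
      by (intro exI[of _ 1] exI[of _ "\<lambda>n. C * real (n + 1) powr (- (1 / 2)) / real (n + 1)"]) auto
  qed auto
  then obtain g g' where "\<And>s. (\<lambda>n. shifted_diff n 0 s / of_nat (n + 1)) sums g s"
      "\<And>s. (g has_field_derivative g' s) (at s)" by auto
  thus ?thesis using that by (metis holomorphic_onI field_differentiable_at_within field_differentiable_def)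
qed

section \<open>Two expansions of one integrand, and zeta for \<open>Re s > 1\<close>\<close>

lemma sums_laplace_kernel_geometric:
  "(\<lambda>m. laplace_kernel s 0 m t) sums
     (indicator {0<..} t *\<^sub>R (of_real t powr (s - 1) * of_real (exp (- t) / (1 - exp (- t)))))"
proof (cases "t > 0")
  case True
  have "(\<lambda>m. exp (- t) * exp (- t) ^ m) sums (exp (- t) * (1 / (1 - exp (- t))))"
    using True by (intro sums_mult geometric_sums) auto
  moreover have "exp (- t) * exp (- t) ^ m = exp (- real (m + 1) * t)" for m
    by (simp add: algebra_simps flip: exp_of_nat_mult exp_add)
  ultimately have "(\<lambda>m. exp (- real (m + 1) * t)) sums (exp (- t) / (1 - exp (- t)))" by simp
  hence "(\<lambda>m. of_real t powr (s - 1) * of_real (exp (- real (m + 1) * t))) sums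
     (of_real t powr (s - 1) * of_real (exp (- t) / (1 - exp (- t))) :: complex)"
    by (intro sums_mult sums_of_real)
  thus ?thesis using True by (simp add: laplace_kernel_def)
qed (auto simp: laplace_kernel_def)

lemma sums_laplace_kernel_log:
  "(\<lambda>n. laplace_kernel (s - 1) n 0 t / of_nat (n + 1)) sums
     (indicator {0<..} t *\<^sub>R (of_real t powr (s - 1) * of_real (exp (- t) / (1 - exp (- t)))))"
proof (cases "t > 0")
  case True
  define x where "x = 1 - exp (- t)"
  have x: "0 < x" "x < 1" using True by (auto simp: x_def)
  \<comment> \<open>The logarithmic series at \<open>- x\<close>; since
    \<open>1 - x = exp (- t)\<close>, its sum is \<open>- t\<close>.\<close>
  have "(\<lambda>n. - ((- (- x)) ^ n) / of_nat n) sums ln (1 + (- x))"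
    using x by (intro ln_series') auto
  from sums_minus[OF this] have "(\<lambda>n. x ^ n / real n) sums t"
    by (simp add: x_def)
  hence "(\<lambda>n. x ^ Suc n / real (Suc n)) sums t" by (subst sums_Suc_iff) simp
  hence "(\<lambda>n. exp (- t) / x * (x ^ Suc n / real (Suc n))) sums (exp (- t) / x * t)" by (rule sums_mult)
  hence "(\<lambda>n. exp (- t) * x ^ n / real (n + 1)) sums (t * (exp (- t) / x))"
    using x by (simp add: field_simps)
  hence "(\<lambda>n. of_real t powr (s - 2) * of_real (exp (- t) * x ^ n / real (n + 1))) sums
     (of_real t powr (s - 2) * of_real (t * (exp (- t) / x)) :: complex)"
    by (intro sums_mult sums_of_real)
  \<comment> \<open>The kernel at \<open>s - 1\<close> contains only \<open>t powr (s - 2)\<close>;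
    the missing factor \<open>t\<close> is the sum of the logarithmic series.\<close>
  moreover have "of_real t powr (s - 1) = of_real t powr (s - 2) * (of_real t :: complex)"
    using True powr_add[of "of_real t" "s - 2" 1] by simp
  ultimately show ?thesis using True by (simp add: laplace_kernel_def x_def mult_ac)
qed (auto simp: laplace_kernel_def)

text \<open>Termwise integration, justified by a summable bound on the integrals of the
  norms.\<close>

lemma sums_integral_of_norm_le:
  fixes f :: "nat \<Rightarrow> 'a \<Rightarrow> 'b :: {banach, second_countable_topology}"
  assumes int: "\<And>n. has_bochner_integral M (f n) (I n)"
    and sums: "\<And>x. (\<lambda>n. f n x) sums F x" "\<And>x. summable (\<lambda>n. norm (f n x))"
    and le: "\<And>n. (\<integral>x. norm (f n x) \<partial>M) \<le> h n" "summable h"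
  shows "I sums (\<integral>x. F x \<partial>M)"
proof -
  have "(\<lambda>n. \<integral>x. f n x \<partial>M) sums (\<integral>x. (\<Sum>n. f n x) \<partial>M)"
    using assms by (intro sums_integral)
      (auto simp: has_bochner_integral_iff intro!: summable_comparison_test'[OF le(2), of 0])
  thus ?thesis using int sums(1) by (simp add: has_bochner_integral_iff sums_iff)
qed

text \<open>Both expansions are integrated termwise. Equating the results gives
  \<open>Gamma s\<close> times the Dirichlet series on one side and \<open>Gamma (s - 1) * g\<close>
  on the other, and \<open>Gamma s = (s - 1) * Gamma (s - 1)\<close>.\<close>

lemma zeta_sums_shifted_diff_series:
  assumes s: "Re s > 1" and g: "(\<lambda>n. shifted_diff n 0 (s - 1) / of_nat (n + 1)) sums g"
  shows "(\<lambda>n. of_nat (Suc n) powr (- s)) sums (g / (s - 1))"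
proof -
  define F where "F = (\<lambda>t. indicator {0<..} t *\<^sub>R
    (of_real t powr (s - 1) * of_real (exp (- t) / (1 - exp (- t))) :: complex))"
  \<comment> \<open>Taking norms replaces \<open>w\<close> by its real part. Absolute convergence of
    either expansion is therefore convergence of the same expansion at a real argument.\<close>
  have norm_kernel: "norm (laplace_kernel w n j t) = Re (laplace_kernel (of_real (Re w)) n j t)" for w n j t
  proof (cases "t > 0")
    case True
    have "of_real t powr (of_real (Re w) - 1) = complex_of_real (t powr (Re w - 1))"
      using True by (simp flip: powr_of_real)
    thus ?thesis using True
      by (simp add: laplace_kernel_def norm_mult norm_power norm_powr_real_powr
          del: of_real_power of_real_diff flip: of_real_mult)
  qed (auto simp: laplace_kernel_def)
  have 1: "(\<lambda>m. Gamma s * of_nat (m + 1) powr (- s)) sums (\<integral>t. F t \<partial>lborel)"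
  proof (rule sums_integral_of_norm_le)
    show "has_bochner_integral lborel (laplace_kernel s 0 m) (Gamma s * of_nat (m + 1) powr (- s))" for m
      using has_bochner_integral_laplace_kernel[of s 0 m] s by (simp add: shifted_diff_def)
    show "(\<lambda>m. laplace_kernel s 0 m t) sums F t" for t
      unfolding F_def by (rule sums_laplace_kernel_geometric)
    show "summable (\<lambda>m. norm (laplace_kernel s 0 m t))" for t
      unfolding norm_kernel
      using sums_laplace_kernel_geometric by (intro summable_Re) (auto simp: sums_iff)
    show "(\<integral>t. norm (laplace_kernel s 0 m t) \<partial>lborel) \<le> Gamma (Re s) * real (m + 1) powr (- Re s)" for m
    proof -
      have "has_bochner_integral lborel (\<lambda>t. Re (laplace_kernel (of_real (Re s)) 0 m t))
          (Re (Gamma (of_real (Re s)) * shifted_diff 0 m (of_real (Re s))))"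
        using s by (intro has_bochner_integral_bounded_linear[OF bounded_linear_Re]
          has_bochner_integral_laplace_kernel) auto
      moreover have "Gamma (of_real (Re s)) * shifted_diff 0 m (of_real (Re s)) =
          complex_of_real (Gamma (Re s) * real (m + 1) powr (- Re s))"
        using powr_of_real[of "real (m + 1)" "- Re s"]
        by (simp add: shifted_diff_def Gamma_complex_of_real)
      ultimately show ?thesis unfolding norm_kernel by (simp add: has_bochner_integral_iff)
    qed
    have "summable (\<lambda>m. real m powr (- Re s))" using s by (simp add: summable_real_powr_iff)
    thus "summable (\<lambda>m. Gamma (Re s) * real (m + 1) powr (- Re s))"
      using summable_ignore_initial_segment[of _ 1] by (intro summable_mult) blast
  qed
  have 2: "(\<lambda>n. Gamma (s - 1) * shifted_diff n 0 (s - 1) / of_nat (n + 1)) sums (\<integral>t. F t \<partial>lborel)"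
  proof (rule sums_integral_of_norm_le)
    show "has_bochner_integral lborel (\<lambda>t. laplace_kernel (s - 1) n 0 t / of_nat (n + 1))
        (Gamma (s - 1) * shifted_diff n 0 (s - 1) / of_nat (n + 1))" for n
      using s by (intro has_bochner_integral_divide_zero has_bochner_integral_laplace_kernel) auto
    show "(\<lambda>n. laplace_kernel (s - 1) n 0 t / of_nat (n + 1)) sums F t" for t
      unfolding F_def by (rule sums_laplace_kernel_log)
    show "summable (\<lambda>n. norm (laplace_kernel (s - 1) n 0 t / of_nat (n + 1)))" for t
    proof -
      have "norm (laplace_kernel (s - 1) n 0 t / of_nat (n + 1)) =
         Re (laplace_kernel (of_real (Re s) - 1) n 0 t / of_nat (n + 1))" for n
        unfolding norm_divide norm_kernel norm_of_nat
        by (simp del: of_nat_Suc of_nat_add)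
      thus ?thesis using summable_Re[OF sums_summable[OF sums_laplace_kernel_log[of "of_real (Re s)" t]]]
        by (simp only:)
    qed
    define C where "C = exp 1 * (1/2) powr (1/2) * (Gamma (Re s - 1) * 2 powr (Re s - 1))"
    show "(\<integral>t. norm (laplace_kernel (s - 1) n 0 t / of_nat (n + 1)) \<partial>lborel) \<le>
       C * real (n + 1) powr (- (1 / 2)) / real (n + 1)" for n
      using integral_norm_laplace_kernel_le[of "s - 1" n 0] s
      unfolding norm_divide norm_of_nat integral_divide_zero C_def
      by (intro divide_right_mono) (simp_all add: mult_ac)
    show "summable (\<lambda>n. C * real (n + 1) powr (- (1 / 2)) / real (n + 1))"
      by (rule summable_powr_three_halves)
  qed
  have nz: "s - 1 \<noteq> 0" "Gamma s \<noteq> 0"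
    using s by (auto simp: Gamma_eq_zero_iff elim!: nonpos_Ints_cases)
  have Gamma_s: "Gamma s = (s - 1) * Gamma (s - 1)"
  proof -
    have "s - 1 \<notin> \<int>\<^sub>\<le>\<^sub>0" using s by (auto elim!: nonpos_Ints_cases simp: complex_eq_iff)
    thus ?thesis using Gamma_plus1[of "s - 1"] by simp
  qed
  have "(\<lambda>n. Gamma (s - 1) * (shifted_diff n 0 (s - 1) / of_nat (n + 1))) sums (Gamma (s - 1) * g)"
    by (intro sums_mult g)
  with 2 have "(\<integral>t. F t \<partial>lborel) = Gamma (s - 1) * g" using sums_unique2 by fastforce
  with 1 have "(\<lambda>m. Gamma s * of_nat (m + 1) powr (- s)) sums (Gamma s * (g / (s - 1)))"
    using nz by (simp add: Gamma_s)
  thus ?thesis using nz(2) by (subst (asm) sums_mult_iff) auto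
qed

section \<open>Continuation of Hasse's formula to all \<open>s \<noteq> 1\<close>\<close>

lemma zeta_eq_hasse:
  assumes "s \<noteq> 1"
  shows "(\<lambda>n. shifted_diff n 0 (s - 1) / of_nat (n + 1)) sums ((s - 1) * zeta s)"
proof -
  obtain g where g: "g holomorphic_on UNIV"
      "\<And>s. (\<lambda>n. shifted_diff n 0 s / of_nat (n + 1)) sums g s"
    using shifted_diff_series_holomorphic by blast
  have "zeta_continuation (\<lambda>s. g (s - 1) / (s - 1))"
    unfolding zeta_continuation_def
  proof safe
    have "(g \<circ> (\<lambda>s. s - 1)) holomorphic_on - {1}"
      by (intro holomorphic_on_compose holomorphic_intros holomorphic_on_subset[OF g(1)]) auto
    thus "(\<lambda>s. g (s - 1) / (s - 1)) holomorphic_on - {1}"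
      by (intro holomorphic_intros) (auto simp: o_def)
  qed (intro zeta_sums_shifted_diff_series g)
  from zeta_eqI[OF this assms] show ?thesis using g(2)[of "s - 1"] assms by simp
qed

section \<open>Pieces, telescoping and Ser's series\<close>

lemma hasse_term_eq_pieces:
  assumes "k \<le> n"
  shows "hasse_term s (n, k) =
    piece s (n, k, True) + (if k < n then piece s (n - 1, k, False) else 0)"
proof -
  define w where "w = (- 1) ^ k * of_nat (k + 1) powr (- s)"
  have "of_nat (k + 1) powr (1 - s) = of_nat (k + 1) powr 1 * (of_nat (k + 1) powr (- s) :: complex)"
    unfolding powr_add[symmetric] by simp
  also have "of_nat (k + 1) powr 1 = (of_nat (k + 1) :: complex)" by (rule powr_to_1)
  finally have "hasse_term s (n, k) = of_nat (k + 1) * of_nat (n choose k) / of_nat (n + 1) * w"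
    by (simp add: hasse_term_def w_def mult_ac)
  moreover have "piece s (n, k, True) = of_nat (n choose k) * w"
    by (simp add: piece_def w_def mult_ac)
  \<comment> \<open>For \<open>k = n\<close> the right-hand side vanishes as well, through the
    binomial coefficient or, if \<open>n = 0\<close>, through the factor \<open>n\<close>. This
    removes the case distinction.\<close>
  moreover have "(if k < n then piece s (n - 1, k, False) else 0) =
      - (of_nat n * of_nat ((n - 1) choose k) / of_nat (n + 1)) * w"
    using assms by (cases n) (auto simp: piece_def w_def mult_ac)
  moreover have "of_nat (k + 1) * of_nat (n choose k) / of_nat (n + 1) =
      of_nat (n choose k) - (of_nat n * of_nat ((n - 1) choose k) / of_nat (n + 1) :: complex)"
  proof -
    have "(n - k) * (n choose k) = n * ((n - 1) choose k)"
      using binomial_absorb_comp by blast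
    hence "(of_nat n - of_nat k) * of_nat (n choose k) = (of_nat n * of_nat ((n - 1) choose k) :: complex)"
      using assms by (metis of_nat_diff of_nat_mult)
    moreover have "(of_nat n + 1 :: complex) \<noteq> 0"
      by (metis of_nat_Suc of_nat_0_eq_iff add.commute nat.distinct(2))
    ultimately show ?thesis by (simp add: divide_simps) (simp add: algebra_simps)
  qed
  ultimately show ?thesis by (simp only: left_diff_distrib) simp
qed

lemma one_div_plus_2: "1 / of_nat (n + 2) = (1 - of_nat (n + 1) / of_nat (n + 2) :: complex)"
proof -
  have "of_nat (n + 2) \<noteq> (0 :: complex)" unfolding of_nat_eq_0_iff by simp
  hence "(of_nat (n + 2) - of_nat (n + 1)) / of_nat (n + 2) =
      (1 - of_nat (n + 1) / of_nat (n + 2) :: complex)"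
    by (metis diff_divide_distrib divide_self)
  moreover have "of_nat (n + 2) - of_nat (n + 1) = (1 :: complex)" by simp
  ultimately show ?thesis by (simp only:)
qed

lemma sum_hasse_term: "(\<Sum>k\<le>n. hasse_term s (n, k)) = shifted_diff n 0 (s - 1) / of_nat (n + 1)"
  by (simp add: hasse_term_def shifted_diff_def sum_divide_distrib)

text \<open>Row \<open>n + 1\<close> of Hasse's series summed by pieces: the \<open>True\<close>
  pieces come from row \<open>n + 1\<close> and the \<open>False\<close> pieces from row
  \<open>n\<close> of Ser's series.\<close>

lemma sum_hasse_term_Suc:
  "(\<Sum>k\<le>Suc n. hasse_term s (Suc n, k)) =
     shifted_diff (Suc n) 0 s - of_nat (n + 1) / of_nat (n + 2) * shifted_diff n 0 s"
proof -
  have "(\<Sum>k\<le>Suc n. hasse_term s (Suc n, k)) =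
      (\<Sum>k\<le>Suc n. piece s (Suc n, k, True)) + (\<Sum>k\<le>Suc n. if k < Suc n then piece s (n, k, False) else 0)"
    unfolding sum.distrib[symmetric] by (intro sum.cong refl) (simp add: hasse_term_eq_pieces)
  also have "(\<Sum>k\<le>Suc n. if k < Suc n then piece s (n, k, False) else 0) = (\<Sum>k\<le>n. piece s (n, k, False))"
    by simp
  also have "\<dots> = - (of_nat (n + 1) / of_nat (n + 2) * shifted_diff n 0 s)"
    by (simp add: piece_def shifted_diff_def sum_distrib_left sum_negf)
  also have "(\<Sum>k\<le>Suc n. piece s (Suc n, k, True)) = shifted_diff (Suc n) 0 s"
    by (simp add: piece_def shifted_diff_def)
  finally show ?thesis by simp
qed

text \<open>In the step from \<open>N\<close> to \<open>N + 1\<close>, the leftover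
  \<open>shifted_diff N 0 s\<close> loses the fraction \<open>(N + 1) / (N + 2)\<close> of itself,
  so that exactly Ser's term \<open>shifted_diff N 0 s / (N + 2)\<close> remains, and
  \<open>shifted_diff (N + 1) 0 s\<close> is the new leftover.\<close>

lemma hasse_partial_sum_eq:
  "(\<Sum>n\<le>N. shifted_diff n 0 (s - 1) / of_nat (n + 1)) =
     shifted_diff N 0 s + (\<Sum>n<N. shifted_diff n 0 s / of_nat (n + 2))"
proof (induction N)
  case 0
  show ?case by (simp add: shifted_diff_def)
next
  case (Suc N)
  let ?c = "of_nat (N + 1) / of_nat (N + 2) :: complex"
  have "(\<Sum>n\<le>Suc N. shifted_diff n 0 (s - 1) / of_nat (n + 1)) =
      shifted_diff N 0 s + (\<Sum>n<N. shifted_diff n 0 s / of_nat (n + 2)) +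
      (shifted_diff (Suc N) 0 s - ?c * shifted_diff N 0 s)"
    using sum_hasse_term_Suc[of s N] unfolding sum_hasse_term
    by (simp only: sum.atMost_Suc Suc.IH)
  also have "\<dots> = shifted_diff (Suc N) 0 s + (\<Sum>n<N. shifted_diff n 0 s / of_nat (n + 2)) +
      (1 - ?c) * shifted_diff N 0 s"
    by (simp only: left_diff_distrib) simp
  finally show ?case unfolding one_div_plus_2[symmetric] by simp
qed

lemma zeta_eq_ser:
  assumes "s \<noteq> 1"
  shows "(\<lambda>n. shifted_diff n 0 s / of_nat (n + 2)) sums ((s - 1) * zeta s)"
proof -
  have "(\<lambda>N. \<Sum>n\<le>N. shifted_diff n 0 (s - 1) / of_nat (n + 1)) \<longlonglongrightarrow> (s - 1) * zeta s"
    using zeta_eq_hasse[OF assms] by (simp add: sums_def_le)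
  from tendsto_diff[OF this shifted_diff_tendsto_0[of 0 s]] show ?thesis
    unfolding hasse_partial_sum_eq sums_def by simp
qed

lemma collects_ser: "collects piece_index (piece s) ser_group term_index (ser_term s)"
  unfolding collects_def
proof (intro conjI ballI)
  show "ser_group ` piece_index \<subseteq> term_index"
    by (auto simp: ser_group_def piece_index_def term_index_def)
next
  fix i assume "i \<in> term_index"
  then obtain n k where i: "i = (n, k)" "k \<le> n" by (auto simp: term_index_def)
  have fib: "{j \<in> piece_index. ser_group j = i} = {(n, k, True), (n, k, False)}"
    using i by (auto simp: piece_index_def ser_group_def)
  have "ser_term s i = piece s (n, k, True) + piece s (n, k, False)"
    unfolding i ser_term_def piece_def prod.case one_div_plus_2 by (simp add: left_diff_distrib)
  thus "finite {j \<in> piece_index. ser_group j = i}"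
    "ser_term s i = (\<Sum>j | j \<in> piece_index \<and> ser_group j = i. piece s j)"
    unfolding fib by auto
qed

lemma collects_hasse: "collects piece_index (piece s) hasse_group term_index (hasse_term s)"
  unfolding collects_def
proof (intro conjI ballI)
  show "hasse_group ` piece_index \<subseteq> term_index"
    by (auto simp: hasse_group_def piece_index_def term_index_def)
next
  fix i assume "i \<in> term_index"
  then obtain n k where i: "i = (n, k)" "k \<le> n" by (auto simp: term_index_def)
  \<comment> \<open>A \<open>False\<close> piece reaches row \<open>n\<close> only from row
    \<open>n - 1\<close>, where the index \<open>k\<close> occurs just when
    \<open>k < n\<close>.\<close>
  have fib: "{j \<in> piece_index. hasse_group j = i} =
      insert (n, k, True) (if k < n then {(n - 1, k, False)} else {})"
    using i by (auto simp: piece_index_def hasse_group_def split: if_splits)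
  show "finite {j \<in> piece_index. hasse_group j = i}"
    "hasse_term s i = (\<Sum>j | j \<in> piece_index \<and> hasse_group j = i. piece s j)"
    unfolding fib using i by (auto simp: hasse_term_eq_pieces)
qed

theorem theorem1:
  fixes s :: complex
  assumes "s \<noteq> 1"
  shows
    "summable (\<lambda>n. 1 / of_nat (n + 2) *
       (\<Sum>k=0..n. (- 1) ^ k * of_nat (n choose k) * of_nat (k + 1) powr (- s)) :: complex) \<and>
     zeta s = 1 / (s - 1) * (\<Sum>n. 1 / of_nat (n + 2) *
       (\<Sum>k=0..n. (- 1) ^ k * of_nat (n choose k) * of_nat (k + 1) powr (- s))) \<and>
     summable (\<lambda>n. 1 / of_nat (n + 1) *
       (\<Sum>k=0..n. (- 1) ^ k * of_nat (n choose k) * of_nat (k + 1) powr (1 - s)) :: complex) \<and>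
     zeta s = 1 / (s - 1) * (\<Sum>n. 1 / of_nat (n + 1) *
       (\<Sum>k=0..n. (- 1) ^ k * of_nat (n choose k) * of_nat (k + 1) powr (1 - s))) \<and>
     rearranges_to piece_index (piece s) ser_group hasse_group term_index
       (ser_term s) (hasse_term s) \<and>
     rearranges_to piece_index (piece s) hasse_group ser_group term_index
       (hasse_term s) (ser_term s)"
proof -
  have ser: "1 / of_nat (n + 2) *
      (\<Sum>k=0..n. (- 1) ^ k * of_nat (n choose k) * of_nat (k + 1) powr (- s)) =
      shifted_diff n 0 s / of_nat (n + 2)" for n
    by (simp add: shifted_diff_def atLeast0AtMost)
  have hasse: "1 / of_nat (n + 1) *
      (\<Sum>k=0..n. (- 1) ^ k * of_nat (n choose k) * of_nat (k + 1) powr (1 - s)) =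
      shifted_diff n 0 (s - 1) / of_nat (n + 1)" for n
    by (simp add: shifted_diff_def atLeast0AtMost)
  show ?thesis
    unfolding ser hasse rearranges_to_def
    using zeta_eq_ser[OF assms] zeta_eq_hasse[OF assms] collects_ser collects_hasse assms
    by (auto simp: sums_iff)
qed

end
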